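(* Let $\mathcal{X},\mathcal{Y}$ be Hilbert spaces, $\mathcal{C}\subset\mathcal{X}$ a nonempty, closed, convex set, and let $F,F_\delta:\mathcal{C}\to\mathcal{Y}$ both be Gateaux differentiable with bounded derivatives $F'[x],F_\delta'[x]$ for all $x\in\mathcal{C}$. Let $x^\dagger\in\mathcal{C}$ and $g\in\mathcal{Y}$ satisfy $F(x^\dagger)=g$. Let $g_\delta\in\mathcal{Y}$ and noise levels $\delta_g,\delta_F,\delta_{F'}\ge 0$ satisfy $$\|g-g_\delta\|\le\delta_g,\qquad \|F(x^\dagger)-F_\delta(x^\dagger)\|\le\delta_F,\qquad \|F'[x^\dagger]-F_\delta'[x^\dagger]\|\le\delta_{F'}.$$ Let $x_0\in\mathcal{C}$ be an initial guess and assume the source condition $$x^\dagger=P_{\mathcal{C}}(F'[x^\dagger]^*\omega+x_0)\quad\text{for some }\omega\in\mathcal{Y}\text{ with }\|\omega\|\le\rho .$$ If $F'[x^\dagger]$ is not injective, assume further that $$x^\dagger=\operatorname{argmin}_{\{x\in\mathcal{C}:F'[x^\dagger](x-x^\dagger)=0\}}\|x-x_0\| .$$ Assume that for some $\gamma>0$ there exists a Lipschitz constant $L>0$ such that $$\|F_\delta'[x]-F_\delta'[x^\dagger]\|\le L\|x-x^\dagger\|\qquad\text{for all }x\in\mathcal{C}\text{ with }\|x-x^\dagger\|\le\gamma .$$ Assume that $\rho$ is sufficiently small, set $$\overline{\delta}:=\max(\delta_g+\delta_F,\delta_{F'}^2),$$ and consider the sequence $(x_n)$ defined by $$x_{n+1}=\operatorname{argmin}_{x\in\mathcal{C}}\left[\|F_\delta'[x_n](x-x_n)+F_\delta(x_n)-g_\delta\|^2+\alpha_n\|x-x_0\|^2\right],\qquad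 n=0,1,2,\dots,$$ with regularization parameters $\alpha_n$ satisfying, for some $r>1$ and all $n\in\mathbb{N}_0$, $$1\le\frac{\alpha_n}{\alpha_{n+1}}\le r,\qquad \lim_{n\to\infty}\alpha_n=0,\qquad \alpha_n>0 .$$ Then the iterates satisfy $\|x_n-x^\dagger\|\le\gamma$, and in the noise-free case $\overline{\delta}=0$ we have $$\|x_n-x^\dagger\|=\mathcal{O}(\sqrt{\alpha_n}),\qquad n\to\infty .$$ For $\overline{\delta}>0$ assume that a stopping index $N$ is chosen such that $$\alpha_N<\eta\overline{\delta}\le\alpha_n,\qquad 0\le n<N,$$ with some constant $\eta>0$ sufficiently large. Then the error of the final approximation fulfills $$\|x_N-x^\dagger\|=\mathcal{O}\left(\sqrt{\overline{\delta}}\right),\qquad\overline{\delta}\to0 .$$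
   Context: $P_{\mathcal{C}}:\mathcal{X}\to\mathcal{C}$ denotes the metric projection onto the nonempty closed convex set $\mathcal{C}$, and $T^*$ denotes the Hilbert space adjoint of a bounded linear operator $T:\mathcal{X}\to\mathcal{Y}$. Norms of bounded linear operators $\mathcal{X}\to\mathcal{Y}$ are operator norms. $F$ is the exact operator and $g$ the exact right-hand side; $F_\delta$ and $g_\delta$ are their given approximations. $F'[x]$ and $F_\delta'[x]$ denote the Gateaux derivatives at $x$.
   Formalization: For positive total noise the bound ‖x_n − x†‖ ≤ γ is stated only for 0 ≤ n ≤ N, N the stopping index; beyond N it can fail (F = F_δ = id on ℝ, x† = x_0 = 0, g_δ = 2γ gives x_n → 2γ). *)

theory Defs
  imports "HOL-Analysis.Analysis" "HOL-Library.Landau_Symbols"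
begin

text \<open>
  Hilbert spaces are rendered by the sorts \<open>{real_inner, complete_space}\<close>. (A complex Hilbert space
  is covered through the real part of its inner product, which changes neither norms nor adjoints.)
  A map \<open>C \<rightarrow> Y\<close> is a total function of which only the values on \<open>C\<close> are used, and a derivative
  \<open>F'\<close> is a function into the bounded linear operators, whose norm is the operator norm.
\<close>

text \<open>
  \<open>D\<close> is a Gateaux derivative at \<open>x\<close> of a map defined on \<open>C\<close>. The difference quotients are restricted
  to those \<open>t\<close> with \<open>x + t h \<in> C\<close>, so that points without a neighbourhood in \<open>C\<close> are allowed; for
  directions \<open>h\<close> that leave \<open>C\<close> immediately the filter is trivial and nothing is required. At interior
  points of \<open>C\<close> this is the usual Gateaux derivative.
\<close>

definition has_gateaux_derivative ::
  "('a::real_normed_vector \<Rightarrow> 'b::real_normed_vector) \<Rightarrow> ('a \<Rightarrow>\<^sub>L 'b) \<Rightarrow> 'a \<Rightarrow> 'a set \<Rightarrow> bool"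
  where "has_gateaux_derivative F D x C \<longleftrightarrow>
    (\<forall>h. ((\<lambda>t::real. (F (x + t *\<^sub>R h) - F x) /\<^sub>R t) \<longlongrightarrow> blinfun_apply D h)
            (at 0 within {t. x + t *\<^sub>R h \<in> C}))"

text \<open>The library's \<open>closest_point\<close> is confined to locally compact spaces.\<close>

definition metric_projection :: "'a::metric_space set \<Rightarrow> 'a \<Rightarrow> 'a"
  where "metric_projection C z = arg_min_on (\<lambda>x. dist z x) C"

primrec irgnm ::
  "'a::real_normed_vector set \<Rightarrow> ('a \<Rightarrow> 'b::real_normed_vector) \<Rightarrow> ('a \<Rightarrow> 'a \<Rightarrow>\<^sub>L 'b) \<Rightarrow> 'b
    \<Rightarrow> (nat \<Rightarrow> real) \<Rightarrow> 'a \<Rightarrow> nat \<Rightarrow> 'a"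
  where
    "irgnm C F F' g \<alpha> x\<^sub>0 0 = x\<^sub>0"
  | "irgnm C F F' g \<alpha> x\<^sub>0 (Suc n) =
       (let z = irgnm C F F' g \<alpha> x\<^sub>0 n in
        arg_min_on
          (\<lambda>x. (norm (blinfun_apply (F' z) (x - z) + F z - g))\<^sup>2 + \<alpha> n * (norm (x - x\<^sub>0))\<^sup>2) C)"

definition total_noise :: "real \<Rightarrow> real \<Rightarrow> real \<Rightarrow> real"
  where "total_noise \<delta>\<^sub>g \<delta>\<^sub>F \<delta>\<^sub>D = max (\<delta>\<^sub>g + \<delta>\<^sub>F) (\<delta>\<^sub>D\<^sup>2)"

text \<open>
  \<open>(F\<^sub>\<delta>, F\<^sub>\<delta>', g\<^sub>\<delta>)\<close> are admissible approximations of the exact \<open>(F, F', g)\<close> with noise levels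
  \<open>\<delta>\<^sub>g, \<delta>\<^sub>F, \<delta>\<^sub>D\<close>, where \<open>\<delta>\<^sub>D\<close> is the noise level of the derivative.
\<close>

definition noisy_data ::
  "'a::real_normed_vector set \<Rightarrow> ('a \<Rightarrow> 'b::real_normed_vector) \<Rightarrow> ('a \<Rightarrow> 'a \<Rightarrow>\<^sub>L 'b) \<Rightarrow> 'a \<Rightarrow> 'b
    \<Rightarrow> real \<Rightarrow> real \<Rightarrow> ('a \<Rightarrow> 'b) \<Rightarrow> ('a \<Rightarrow> 'a \<Rightarrow>\<^sub>L 'b) \<Rightarrow> 'b \<Rightarrow> real \<Rightarrow> real \<Rightarrow> real \<Rightarrow> bool"
  where "noisy_data C F F' xd g \<gamma> L F\<^sub>\<delta> F\<^sub>\<delta>' g\<^sub>\<delta> \<delta>\<^sub>g \<delta>\<^sub>F \<delta>\<^sub>D \<longleftrightarrow>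
    0 \<le> \<delta>\<^sub>g \<and> 0 \<le> \<delta>\<^sub>F \<and> 0 \<le> \<delta>\<^sub>D \<and>
    (\<forall>x\<in>C. has_gateaux_derivative F\<^sub>\<delta> (F\<^sub>\<delta>' x) x C) \<and>
    norm (g - g\<^sub>\<delta>) \<le> \<delta>\<^sub>g \<and>
    norm (F xd - F\<^sub>\<delta> xd) \<le> \<delta>\<^sub>F \<and>
    norm (F' xd - F\<^sub>\<delta>' xd) \<le> \<delta>\<^sub>D \<and>
    (\<forall>x\<in>C. norm (x - xd) \<le> \<gamma> \<longrightarrow> norm (F\<^sub>\<delta>' x - F\<^sub>\<delta>' xd) \<le> L * norm (x - xd))"

definition stopping_index :: "(nat \<Rightarrow> real) \<Rightarrow> real \<Rightarrow> real \<Rightarrow> nat \<Rightarrow> bool"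
  where "stopping_index \<alpha> \<eta> \<delta> N \<longleftrightarrow> \<alpha> N < \<eta> * \<delta> \<and> (\<forall>n<N. \<eta> * \<delta> \<le> \<alpha> n)"

end

theory Submission
  imports Defs
begin

text \<open>
  Write \<open>T = F'[x\<^sup>\<dagger>]\<close> and \<open>e\<^sub>n = \<parallel>x\<^sub>n - x\<^sup>\<dagger>\<parallel>\<close>. Every step of the iteration minimises a Tikhonov
  functional \<open>\<parallel>A x - b\<parallel>\<^sup>2 + \<alpha>\<^sub>n \<parallel>x - x\<^sub>0\<parallel>\<^sup>2\<close> over \<open>C\<close>, and the proof compares its value at the minimiser
  \<open>x\<^sub>n\<^sub>+\<^sub>1\<close> with its value at \<open>x\<^sup>\<dagger>\<close>. Three facts enter.

  \<^item> The projection in the source condition yields a variational inequality,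
    \<open>\<langle>x\<^sub>0 - x\<^sup>\<dagger>, x - x\<^sup>\<dagger>\<rangle> \<le> \<parallel>\<omega>\<parallel> \<parallel>T (x - x\<^sup>\<dagger>)\<parallel>\<close> on \<open>C\<close> (\<open>source_condition_inequality\<close>): the penalty grows
    quadratically away from \<open>x\<^sup>\<dagger>\<close> up to a multiple of the linearised residual.
  \<^item> The Lipschitz bound makes the linearisation error at \<open>x\<^sub>n\<close> quadratic in \<open>e\<^sub>n\<close>
    (\<open>gateaux_linearization_error\<close>), so the residual at \<open>x\<^sup>\<dagger>\<close> is at most \<open>2 L e\<^sub>n\<^sup>2 + \<delta>\<^sub>g + \<delta>\<^sub>F\<close>.
  \<^item> The term \<open>\<parallel>\<omega>\<parallel> \<parallel>T (x\<^sub>n\<^sub>+\<^sub>1 - x\<^sup>\<dagger>)\<parallel>\<close> can be absorbed into the residual and penalty of the new iterate, at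
    the cost of terms of order \<open>\<parallel>\<omega>\<parallel>\<close> and constant factors (\<open>tikhonov_step_error\<close>).

  Together they give (\<open>irgnm_step_error\<close>)
  \<open>e\<^sub>n\<^sub>+\<^sub>1 \<le> 2 (2 L e\<^sub>n\<^sup>2 + \<delta>\<^sub>g + \<delta>\<^sub>F) / \<surd>\<alpha>\<^sub>n + 2 \<parallel>\<omega>\<parallel> \<surd>\<alpha>\<^sub>n + 2 \<parallel>\<omega>\<parallel> (L e\<^sub>n + \<delta>\<^sub>D)\<close>.
  In terms of \<open>u\<^sub>n = e\<^sub>n / \<surd>\<alpha>\<^sub>n\<close> and as long as the total noise is at most \<open>\<tau>\<^sup>2 \<alpha>\<^sub>n\<close>, this is a quadratic
  recursion whose linear and constant coefficients shrink with \<open>\<parallel>\<omega>\<parallel>\<close> and \<open>\<tau>\<close>. Hence a small enough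
  bound \<open>u\<^sub>n \<le> U\<close> reproduces itself (\<open>irgnm_error_invariant\<close>). The stopping rule supplies
  \<open>\<tau> = 1/\<surd>\<eta>\<close> before index \<open>N\<close>, zero total noise allows \<open>\<tau> = 0\<close> at all indices; at the stopping index
  \<open>\<surd>\<alpha>\<^sub>N < \<surd>(\<eta> \<delta>)\<close> turns the bound into the claimed rate.
\<close>

section \<open>Constrained quadratic minimisation in Hilbert spaces\<close>

text \<open>
  Besides the steps of the iteration, two classical objects come from minimising this functional:
  \<open>A = 0\<close> gives the metric projection of \<open>p\<close>, and a real-valued \<open>A\<close> on the whole space leads to the
  Riesz representative of \<open>A\<close>.
\<close>

definition tikhonov :: "('a::real_normed_vector \<Rightarrow>\<^sub>L 'b::real_normed_vector) \<Rightarrow> 'b \<Rightarrow> real \<Rightarrow> 'a \<Rightarrow> 'a \<Rightarrow> real"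
  where "tikhonov A b a p x = (norm (A x - b))\<^sup>2 + a * (norm (x - p))\<^sup>2"

text \<open>
  The parallelogram law, applied to both squares. The subtracted term measures strong convexity; it
  is what forces minimising sequences to be Cauchy.
\<close>

lemma tikhonov_midpoint:
  fixes A :: "'a::real_inner \<Rightarrow>\<^sub>L 'b::real_inner"
  shows "tikhonov A b a p ((1/2) *\<^sub>R (x + y)) =
    (tikhonov A b a p x + tikhonov A b a p y) / 2 - ((norm (A (x - y)))\<^sup>2 + a * (norm (x - y))\<^sup>2) / 4"
proof -
  have mid: "(norm ((1/2) *\<^sub>R (u + v)))\<^sup>2 = ((norm u)\<^sup>2 + (norm v)\<^sup>2) / 2 - (norm (u - v))\<^sup>2 / 4"
    for u v :: "'c::real_inner"
    by (simp add: power2_norm_eq_inner inner_add inner_diff inner_commute[of v u] field_simps)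
  have 1: "A ((1/2) *\<^sub>R (x + y)) - b = (1/2) *\<^sub>R ((A x - b) + (A y - b))"
    by (simp add: blinfun.add_right blinfun.scaleR_right algebra_simps flip: scaleR_2)
  have 2: "(1/2) *\<^sub>R (x + y) - p = (1/2) *\<^sub>R ((x - p) + (y - p))"
    by (simp add: algebra_simps flip: scaleR_2)
  show ?thesis
    unfolding tikhonov_def 1 2 mid by (simp add: blinfun.diff_right field_simps)
qed

text \<open>
  The midpoint of two almost-minimisers cannot fall below the infimum, so by strong convexity
  they are close together. Thus completeness does the work that compactness does in finite dimension.
\<close>

lemma tikhonov_minimizer_exists:
  fixes A :: "'a::{real_inner, complete_space} \<Rightarrow>\<^sub>L 'b::real_inner"
  assumes C: "C \<noteq> {}" "closed C" "convex C" and a: "a > 0"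
  shows "\<exists>x\<in>C. \<forall>y\<in>C. tikhonov A b a p x \<le> tikhonov A b a p y"
proof -
  let ?Q = "tikhonov A b a p"
  define m where "m = (INF x\<in>C. ?Q x)"
  have bdd: "bdd_below (?Q ` C)"
    using a by (intro bdd_belowI2[where m=0]) (simp add: tikhonov_def)
  have m_le: "m \<le> ?Q x" if "x \<in> C" for x
    unfolding m_def using bdd that by (rule cINF_lower)
  have "\<exists>x\<in>C. ?Q x < m + inverse (real (Suc n))" for n
    using cINF_less_iff[OF C(1) bdd, of "m + inverse (real (Suc n))"] unfolding m_def by simp
  then obtain X where X: "\<And>n. X n \<in> C" "\<And>n. ?Q (X n) < m + inverse (real (Suc n))"
    by metis
  have close: "a * (norm (X i - X j))\<^sup>2 \<le> 4 * inverse (real (Suc k))" if "k \<le> i" "k \<le> j" for i j k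
  proof -
    have "(1/2) *\<^sub>R (X i + X j) \<in> C"
      using convexD[OF C(3) X(1)[of i] X(1)[of j], of "1/2" "1/2"] by (simp add: scaleR_add_right)
    then have 1: "m \<le> ?Q ((1/2) *\<^sub>R (X i + X j))" by (rule m_le)
    have "inverse (real (Suc i)) \<le> inverse (real (Suc k))" "inverse (real (Suc j)) \<le> inverse (real (Suc k))"
      using that by auto
    moreover have "0 \<le> (norm (A (X i - X j)))\<^sup>2" by simp
    ultimately show ?thesis
      using 1 X(2)[of i] X(2)[of j] unfolding tikhonov_midpoint by argo
  qed
  have "Cauchy X"
  proof (rule metric_CauchyI)
    fix e :: real assume e: "e > 0"
    obtain k where k: "inverse (real (Suc k)) < a * e\<^sup>2 / 4"
      using reals_Archimedean[of "a * e\<^sup>2 / 4"] a e by auto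
    have "dist (X i) (X j) < e" if "i \<ge> k" "j \<ge> k" for i j
    proof -
      have "a * (norm (X i - X j))\<^sup>2 < a * e\<^sup>2" using close[OF that] k by linarith
      then have "(norm (X i - X j))\<^sup>2 < e\<^sup>2" using a by simp
      then show ?thesis using e by (simp add: dist_norm power2_less_imp_less)
    qed
    then show "\<exists>M. \<forall>i\<ge>M. \<forall>j\<ge>M. dist (X i) (X j) < e" by blast
  qed
  then obtain x where x: "X \<longlonglongrightarrow> x" using Cauchy_convergent convergent_def by blast
  have "x \<in> C" using closed_sequentially[OF C(2) X(1) x] .
  have "(\<lambda>n. ?Q (X n)) \<longlonglongrightarrow> ?Q x"
    unfolding tikhonov_def by (intro tendsto_intros x)
  moreover have "(\<lambda>n. m + inverse (real (Suc n))) \<longlonglongrightarrow> m + 0"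
    by (intro tendsto_intros LIMSEQ_inverse_real_of_nat)
  ultimately have "?Q x \<le> m + 0"
    using X(2) by (intro LIMSEQ_le) (auto intro: less_imp_le)
  then show ?thesis using \<open>x \<in> C\<close> m_le by force
qed

text \<open>
  First-order optimality: moving from \<open>v\<close> by a fraction \<open>t\<close> towards \<open>x\<close> changes the functional by
  \<open>t (2 c + t q)\<close>, where \<open>c\<close> is the expression in question. This is nonnegative for small \<open>t > 0\<close> only
  if \<open>c\<close> is.
\<close>

lemma tikhonov_minimizer_variational_inequality:
  fixes A :: "'a::real_inner \<Rightarrow>\<^sub>L 'b::real_inner"
  assumes "convex C" and v: "v \<in> C" "\<And>y. y \<in> C \<Longrightarrow> tikhonov A b a p v \<le> tikhonov A b a p y" and x: "x \<in> C"
  shows "0 \<le> inner (A v - b) (A (x - v)) + a * inner (v - p) (x - v)"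
proof -
  define c where "c = inner (A v - b) (A (x - v)) + a * inner (v - p) (x - v)"
  define q where "q = (norm (A (x - v)))\<^sup>2 + a * (norm (x - v))\<^sup>2"
  have expand: "(norm (u + t *\<^sub>R w))\<^sup>2 = (norm u)\<^sup>2 + 2 * t * inner u w + t\<^sup>2 * (norm w)\<^sup>2"
    for u w :: "'c::real_inner" and t :: real
    unfolding power2_norm_eq_inner by (simp add: inner_commute[of w u] power2_eq_square algebra_simps)
  have ineq: "0 \<le> 2 * c + t * q" if t: "0 < t" "t \<le> 1" for t
  proof -
    have "(1 - t) *\<^sub>R v + t *\<^sub>R x \<in> C"
      using \<open>convex C\<close> v(1) x t by (intro convexD) auto
    moreover have "(1 - t) *\<^sub>R v + t *\<^sub>R x = v + t *\<^sub>R (x - v)" by (simp add: algebra_simps)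
    ultimately have "tikhonov A b a p v \<le> tikhonov A b a p (v + t *\<^sub>R (x - v))" using v(2) by simp
    also have "\<dots> = (norm ((A v - b) + t *\<^sub>R A (x - v)))\<^sup>2 + a * (norm ((v - p) + t *\<^sub>R (x - v)))\<^sup>2"
      unfolding tikhonov_def blinfun.add_right blinfun.scaleR_right by (simp add: add_diff_eq add.commute diff_add_eq)
    also have "\<dots> = tikhonov A b a p v + t * (2 * c + t * q)"
      unfolding tikhonov_def c_def q_def expand by (simp add: algebra_simps power2_eq_square)
    finally have "0 \<le> t * (2 * c + t * q)" by simp
    then show ?thesis using t by (simp add: zero_le_mult_iff)
  qed
  have "((\<lambda>t. 2 * c + t * q) \<longlongrightarrow> 2 * c + 0 * q) (at_right 0)"
    by (intro tendsto_intros)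
  moreover have "\<forall>\<^sub>F t in at_right (0::real). 0 \<le> 2 * c + t * q"
    using eventually_at_right_real[of 0 1] by (rule eventually_mono) (auto intro: ineq)
  ultimately have "0 \<le> 2 * c + 0 * q" by (intro tendsto_lowerbound) auto
  then show ?thesis by (simp add: c_def)
qed

text \<open>
  Take the minimiser \<open>v\<close> of \<open>(f x - 1)\<^sup>2 + \<parallel>x\<parallel>\<^sup>2\<close>. Its first-order condition in the directions \<open>\<plusminus>x\<close>
  reads \<open>\<langle>v, x\<rangle> = (1 - f v) f x\<close>, so a multiple of \<open>v\<close> represents \<open>f\<close>.
\<close>

lemma riesz_representation:
  fixes f :: "'a::{real_inner, complete_space} \<Rightarrow>\<^sub>L real"
  shows "\<exists>v. \<forall>x. f x = inner x v"
proof -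
  obtain v where v: "\<And>y. tikhonov f 1 1 0 v \<le> tikhonov f 1 1 0 y"
    using tikhonov_minimizer_exists[of UNIV 1 f 1 0] by auto
  have ge: "0 \<le> (f v - 1) * f x + inner v x" for x
    using tikhonov_minimizer_variational_inequality[of UNIV v f 1 1 0 "x + v"] v by simp
  have eq: "inner v x = (1 - f v) * f x" for x
    using ge[of x] ge[of "- x"] by (simp add: blinfun.minus_right algebra_simps)
  have "f v \<noteq> 1"
  proof
    assume "f v = 1"
    with eq[of v] have "v = 0" by simp
    with \<open>f v = 1\<close> show False by simp
  qed
  then have "f x = inner x (v /\<^sub>R (1 - f v))" for x
    using eq[of x] by (simp add: inner_commute)
  then show ?thesis by blast
qed

text \<open>
  The constant \<^const>\<open>adjoint\<close> is a choice among the functions that satisfy the adjoint identity;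
  the Riesz theorem shows that one exists.
\<close>

lemma inner_adjoint:
  fixes A :: "'a::{real_inner, complete_space} \<Rightarrow>\<^sub>L 'b::real_inner"
  shows "inner (A x) y = inner x (adjoint A y)"
proof -
  have "\<exists>v. \<forall>x. inner (A x) y = inner x v" for y
  proof -
    have "bounded_linear (\<lambda>x. inner (A x) y)"
      by (intro bounded_linear_compose[OF bounded_linear_inner_left] blinfun.bounded_linear_right)
    from riesz_representation[of "Blinfun (\<lambda>x. inner (A x) y)"] bounded_linear_Blinfun_apply[OF this]
    show ?thesis by simp
  qed
  then obtain A' where "\<forall>x y. inner (A x) y = inner x (A' y)" by metis
  then have "\<forall>x y. inner (A x) y = inner x (adjoint A y)"
    unfolding adjoint_def by (rule someI[where P = "\<lambda>A'. \<forall>x y. inner (A x) y = inner x (A' y)"])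
  then show ?thesis by blast
qed

lemma arg_min_on_minimizer:
  fixes f :: "'a \<Rightarrow> 'b::linorder"
  assumes "\<exists>x\<in>S. \<forall>y\<in>S. f x \<le> f y"
  shows "arg_min_on f S \<in> S" and "y \<in> S \<Longrightarrow> f (arg_min_on f S) \<le> f y"
proof -
  have "is_arg_min f (\<lambda>x. x \<in> S) (arg_min_on f S)"
    unfolding arg_min_on_def arg_min_def
    by (rule someI_ex) (use assms in \<open>force simp: is_arg_min_def not_less\<close>)
  then show "arg_min_on f S \<in> S" and "y \<in> S \<Longrightarrow> f (arg_min_on f S) \<le> f y"
    by (auto simp: is_arg_min_linorder)
qed

lemma metric_projection_variational_inequality:
  fixes z :: "'a::{real_inner, complete_space}"
  assumes C: "C \<noteq> {}" "closed C" "convex C" and "x \<in> C"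
  shows "inner (z - metric_projection C z) (x - metric_projection C z) \<le> 0"
proof -
  have dist_eq: "tikhonov (0 :: 'a \<Rightarrow>\<^sub>L real) 0 1 z y = (dist z y)\<^sup>2" for y
    by (simp add: tikhonov_def dist_norm norm_minus_commute)
  have ex: "\<exists>x\<in>C. \<forall>y\<in>C. dist z x \<le> dist z y"
    using tikhonov_minimizer_exists[OF C, of 1 "0 :: 'a \<Rightarrow>\<^sub>L real" 0 z]
    by (auto simp: dist_eq power2_le_iff_abs_le)
  have "0 \<le> inner (metric_projection C z - z) (x - metric_projection C z)"
    using tikhonov_minimizer_variational_inequality[OF C(3), of "metric_projection C z" "0 :: 'a \<Rightarrow>\<^sub>L real" 0 1 z x]
      arg_min_on_minimizer[OF ex] \<open>x \<in> C\<close>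
    by (simp add: dist_eq metric_projection_def)
  then show ?thesis by (simp add: algebra_simps)
qed

section \<open>Source condition and linearisation error\<close>

text \<open>
  The variational inequality of the projection reads
  \<open>\<langle>T\<^sup>*\<omega> + x\<^sub>0 - x\<^sup>\<dagger>, x - x\<^sup>\<dagger>\<rangle> \<le> 0\<close>; moving \<open>T\<^sup>*\<close> to the other side of the inner product leaves a term
  that Cauchy-Schwarz bounds.
\<close>

lemma source_condition_inequality:
  fixes T :: "'a::{real_inner, complete_space} \<Rightarrow>\<^sub>L 'b::real_inner"
  assumes C: "C \<noteq> {}" "closed C" "convex C" and "x \<in> C"
    and xd: "xd = metric_projection C (adjoint T \<omega> + x0)"
  shows "inner (x0 - xd) (x - xd) \<le> norm \<omega> * norm (T (x - xd))"
proof -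
  have "inner (adjoint T \<omega> + x0 - xd) (x - xd) \<le> 0"
    using metric_projection_variational_inequality[OF C \<open>x \<in> C\<close>] unfolding xd .
  then have "inner (x0 - xd) (x - xd) \<le> - inner (T (x - xd)) \<omega>"
    by (simp add: inner_adjoint inner_commute[of _ "adjoint T \<omega>"] inner_add_left inner_diff_left)
  also have "\<dots> \<le> norm (T (x - xd)) * norm \<omega>"
    using Cauchy_Schwarz_ineq2[of "T (x - xd)" \<omega>] by linarith
  finally show ?thesis by (simp add: mult.commute)
qed

text \<open>
  Restricted to the segment from \<open>x\<^sup>\<dagger>\<close> to \<open>z\<close>, a Gateaux derivative relative to \<open>C\<close> is an ordinary
  derivative of a curve on \<open>[0,1]\<close>, so the mean value inequality applies. The hypothesis compares
  derivatives only with the one at \<open>x\<^sup>\<dagger>\<close>; therefore \<open>F\<close> is linearised there, and replacing \<open>F'[x\<^sup>\<dagger>]\<close> by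
  \<open>F'[z]\<close> costs another \<open>L \<parallel>z - x\<^sup>\<dagger>\<parallel>\<^sup>2\<close>, whence the factor \<open>2\<close>.
\<close>

lemma gateaux_linearization_error:
  fixes F :: "'a::real_normed_vector \<Rightarrow> 'b::real_normed_vector"
  assumes C: "convex C" and G: "\<forall>x\<in>C. has_gateaux_derivative F (F' x) x C"
    and lip: "\<forall>x\<in>C. norm (x - xd) \<le> \<gamma> \<longrightarrow> norm (F' x - F' xd) \<le> L * norm (x - xd)"
    and L: "0 \<le> L" and xd: "xd \<in> C" and z: "z \<in> C" "norm (z - xd) \<le> \<gamma>"
  shows "norm (F' z (xd - z) + F z - F xd) \<le> 2 * L * (norm (z - xd))\<^sup>2"
proof -
  define h where "h = z - xd"
  have in_C: "xd + t *\<^sub>R h \<in> C" if "t \<in> {0..1}" for t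
  proof -
    have "(1 - t) *\<^sub>R xd + t *\<^sub>R z \<in> C" using that C xd z by (intro convexD) auto
    then show ?thesis by (simp add: h_def algebra_simps)
  qed
  have deriv: "((\<lambda>t. F (xd + t *\<^sub>R h)) has_vector_derivative F' (xd + t *\<^sub>R h) h) (at t within {0..1})"
    if t: "t \<in> {0..1}" for t
  proof -
    define p where "p = xd + t *\<^sub>R h"
    have "((\<lambda>s. (F (p + s *\<^sub>R h) - F p) /\<^sub>R s) \<longlongrightarrow> F' p h) (at 0 within {s. p + s *\<^sub>R h \<in> C})"
      using G in_C[OF t] unfolding p_def has_gateaux_derivative_def by blast
    moreover have "filterlim (\<lambda>s. s - t) (at 0 within {s. p + s *\<^sub>R h \<in> C}) (at t within {0..1})"
      unfolding filterlim_at
    proof (intro conjI)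
      have "((\<lambda>s. s - t) \<longlongrightarrow> t - t) (at t within {0..1})" by (intro tendsto_intros)
      then show "((\<lambda>s. s - t) \<longlongrightarrow> 0) (at t within {0..1})" by simp
      have "p + (s - t) *\<^sub>R h \<in> C" if "s \<in> {0..1}" for s
        using in_C[OF that] by (simp add: p_def algebra_simps)
      then show "\<forall>\<^sub>F s in at t within {0..1}. s - t \<in> {s. p + s *\<^sub>R h \<in> C} \<and> s - t \<noteq> 0"
        by (auto simp: eventually_at_filter)
    qed
    ultimately have "((\<lambda>s. (F (p + (s - t) *\<^sub>R h) - F p) /\<^sub>R (s - t)) \<longlongrightarrow> F' p h) (at t within {0..1})"
      by (rule filterlim_compose)
    then have "((\<lambda>s. norm ((F (p + (s - t) *\<^sub>R h) - F p) /\<^sub>R (s - t) - F' p h)) \<longlongrightarrow> 0) (at t within {0..1})"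
      by (simp add: tendsto_norm_zero LIM_zero)
    moreover have "\<forall>\<^sub>F s in at t within {0..1}. norm ((F (p + (s - t) *\<^sub>R h) - F p) /\<^sub>R (s - t) - F' p h)
        = norm (F (xd + s *\<^sub>R h) - F (xd + t *\<^sub>R h) - (s - t) *\<^sub>R F' p h) / norm (s - t)"
    proof -
      have "norm ((F (p + (s - t) *\<^sub>R h) - F p) /\<^sub>R (s - t) - F' p h)
        = norm (F (xd + s *\<^sub>R h) - F (xd + t *\<^sub>R h) - (s - t) *\<^sub>R F' p h) / norm (s - t)" if "s \<noteq> t" for s
      proof -
        have "p + (s - t) *\<^sub>R h = xd + s *\<^sub>R h" by (simp add: p_def scaleR_diff_left)
        then have "(F (p + (s - t) *\<^sub>R h) - F p) /\<^sub>R (s - t) - F' p h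
            = (F (xd + s *\<^sub>R h) - F p - (s - t) *\<^sub>R F' p h) /\<^sub>R (s - t)"
          using that by (simp add: scaleR_diff_right[of "inverse (s - t)"])
        then have "norm ((F (p + (s - t) *\<^sub>R h) - F p) /\<^sub>R (s - t) - F' p h)
            = norm ((F (xd + s *\<^sub>R h) - F p - (s - t) *\<^sub>R F' p h) /\<^sub>R (s - t))" by (rule arg_cong)
        also have "\<dots> = norm (F (xd + s *\<^sub>R h) - F (xd + t *\<^sub>R h) - (s - t) *\<^sub>R F' p h) / norm (s - t)"
          by (simp add: p_def divide_inverse mult.commute)
        finally show ?thesis .
      qed
      then show ?thesis by (simp add: eventually_at_filter)
    qed
    ultimately have "((\<lambda>s. norm (F (xd + s *\<^sub>R h) - F (xd + t *\<^sub>R h) - (s - t) *\<^sub>R F' p h) / norm (s - t))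
        \<longlongrightarrow> 0) (at t within {0..1})"
      by (rule Lim_transform_eventually)
    then show ?thesis
      unfolding has_vector_derivative_def has_derivative_iff_norm p_def
      by (simp add: bounded_linear_scaleR_left)
  qed
  have bound: "norm (F' (xd + t *\<^sub>R h) h - F' (xd + 0 *\<^sub>R h) h) \<le> L * (norm h)\<^sup>2" if t: "t \<in> {0..1}" for t
  proof -
    have th: "norm (t *\<^sub>R h) \<le> norm h" using t by (simp add: mult_left_le_one_le)
    then have "norm (F' (xd + t *\<^sub>R h) - F' xd) \<le> L * norm (t *\<^sub>R h)"
      using lip[rule_format, OF in_C[OF t]] z(2) by (simp add: h_def)
    also have "\<dots> \<le> L * norm h" using th L by (rule mult_left_mono)
    finally have "norm ((F' (xd + t *\<^sub>R h) - F' xd) h) \<le> (L * norm h) * norm h"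
      using norm_blinfun[of "F' (xd + t *\<^sub>R h) - F' xd" h] by (meson mult_right_mono norm_ge_zero order_trans)
    then show ?thesis by (simp add: blinfun.diff_left power2_eq_square mult.assoc)
  qed
  have "norm (F (xd + 1 *\<^sub>R h) - F (xd + 0 *\<^sub>R h) - (1 - 0) *\<^sub>R F' (xd + 0 *\<^sub>R h) h) \<le> norm (1 - 0 :: real) * (L * (norm h)\<^sup>2)"
    by (rule vector_differentiable_bound_linearization[where S = "{0..1}"])
      (use deriv bound in \<open>auto simp: closed_segment_eq_real_ivl\<close>)
  then have 1: "norm (F z - F xd - F' xd h) \<le> L * (norm h)\<^sup>2" by (simp add: h_def)
  have 2: "norm (F' z h - F' xd h) \<le> L * (norm h)\<^sup>2" using bound[of 1] by (simp add: h_def)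
  have "F' z (xd - z) + F z - F xd = (F z - F xd - F' xd h) - (F' z h - F' xd h)"
    by (simp add: h_def blinfun.diff_right)
  then have "norm (F' z (xd - z) + F z - F xd) \<le> norm (F z - F xd - F' xd h) + norm (F' z h - F' xd h)"
    by (metis norm_triangle_ineq4)
  with 1 2 show ?thesis by (simp add: h_def)
qed

section \<open>Error estimate for one step\<close>

text \<open>
  Young's inequality, three times: the terms linear in \<open>s\<close>, \<open>B\<close> and \<open>e\<close> are absorbed by their squares.
  Here \<open>s\<close> stands for the residual of the new iterate, \<open>B\<close> for the residual of the solution, \<open>e\<close> for the
  new error, \<open>w\<close> for \<open>\<parallel>\<omega>\<parallel>\<close> and \<open>d\<close> for a bound on the error of the derivative.
\<close>

lemma absorb_residual_and_source:
  fixes a s e B w d :: real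
  assumes a: "a > 0" and nonneg: "0 \<le> B" "0 \<le> w" "0 \<le> d"
    and ineq: "s\<^sup>2 + a * e\<^sup>2 \<le> B\<^sup>2 + 2 * a * w * (s + B + d * e)"
  shows "e \<le> 2 * B / sqrt a + 2 * w * sqrt a + 2 * w * d"
proof -
  have "0 \<le> (s - a * w)\<^sup>2" "0 \<le> (B - a * w)\<^sup>2" "0 \<le> a * (e - 2 * w * d)\<^sup>2"
    using a by simp_all
  with ineq have "a * e\<^sup>2 \<le> 4 * B\<^sup>2 + 4 * a\<^sup>2 * w\<^sup>2 + 4 * a * w\<^sup>2 * d\<^sup>2"
    by (simp add: power2_eq_square algebra_simps)
  then have "e\<^sup>2 \<le> 4 * B\<^sup>2 / a + 4 * w\<^sup>2 * a + 4 * w\<^sup>2 * d\<^sup>2"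
    using a by (simp add: field_simps power2_eq_square)
  also have "\<dots> = (2 * B / sqrt a)\<^sup>2 + (2 * w * sqrt a)\<^sup>2 + (2 * w * d)\<^sup>2"
    using a by (simp add: power_mult_distrib power_divide)
  also have "\<dots> \<le> (2 * B / sqrt a + 2 * w * sqrt a + 2 * w * d)\<^sup>2"
  proof -
    have "x\<^sup>2 + y\<^sup>2 + z\<^sup>2 \<le> (x + y + z)\<^sup>2" if "0 \<le> x" "0 \<le> y" "0 \<le> z" for x y z :: real
      using that by (simp add: power2_eq_square algebra_simps)
    then show ?thesis using a nonneg by simp
  qed
  finally show ?thesis
    by (rule power2_le_imp_le) (use a nonneg in simp)
qed

text \<open>
  Only the exact derivative \<open>T\<close> occurs in the source inequality, whereas the functional controls the
  approximate one, \<open>A\<close>. The term \<open>\<parallel>T (x - x\<^sup>\<dagger>)\<parallel>\<close> is therefore estimated by the two residuals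
  \<open>\<parallel>A x - b\<parallel>\<close> and \<open>\<parallel>A x\<^sup>\<dagger> - b\<parallel>\<close> and by \<open>d \<parallel>x - x\<^sup>\<dagger>\<parallel>\<close>; minimality compares the squares of the residuals.
\<close>

lemma tikhonov_step_error:
  fixes T A :: "'a::real_inner \<Rightarrow>\<^sub>L 'b::real_inner"
  assumes a: "a > 0" and w: "0 \<le> w" and d: "norm (A - T) \<le> d"
    and min: "tikhonov A b a x0 x \<le> tikhonov A b a x0 xd"
    and src: "inner (x0 - xd) (x - xd) \<le> w * norm (T (x - xd))"
  shows "norm (x - xd) \<le> 2 * norm (A xd - b) / sqrt a + 2 * w * sqrt a + 2 * w * d"
proof (rule absorb_residual_and_source)
  define h where "h = x - xd"
  define s where "s = norm (A x - b)"
  have "norm (T h) \<le> norm (A x - b) + norm (A xd - b) + norm ((A - T) h)"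
  proof -
    have "norm (T h) = norm ((A x - b) - (A xd - b) - (A - T) h)"
      by (simp add: h_def blinfun.diff_left blinfun.diff_right)
    then show ?thesis
      using norm_triangle_ineq4[of "(A x - b) - (A xd - b)" "(A - T) h"] norm_triangle_ineq4[of "A x - b" "A xd - b"]
      by linarith
  qed
  also have "norm ((A - T) h) \<le> d * norm h"
    using norm_blinfun[of "A - T" h] mult_right_mono[OF d norm_ge_zero[of h]] by linarith
  finally have Th: "norm (T h) \<le> s + norm (A xd - b) + d * norm h" by (simp add: s_def)
  have "(norm (x - x0))\<^sup>2 = (norm h)\<^sup>2 - 2 * inner (x0 - xd) h + (norm (xd - x0))\<^sup>2"
  proof -
    have "x - x0 = h - (x0 - xd)" by (simp add: h_def)
    moreover have "(norm (h - k))\<^sup>2 = (norm h)\<^sup>2 - 2 * inner k h + (norm k)\<^sup>2" for k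
      unfolding power2_norm_eq_inner by (simp add: inner_diff inner_commute[of h k])
    ultimately show ?thesis by (simp only: norm_minus_commute[of xd x0])
  qed
  with min have "s\<^sup>2 + a * (norm h)\<^sup>2 \<le> (norm (A xd - b))\<^sup>2 + 2 * a * inner (x0 - xd) h"
    by (simp add: tikhonov_def s_def algebra_simps)
  also have "inner (x0 - xd) h \<le> w * (s + norm (A xd - b) + d * norm h)"
    using src mult_left_mono[OF Th w] by (simp add: h_def)
  finally show "(norm (A x - b))\<^sup>2 + a * (norm (x - xd))\<^sup>2
      \<le> (norm (A xd - b))\<^sup>2 + 2 * a * w * (norm (A x - b) + norm (A xd - b) + d * norm (x - xd))"
    using a by (simp add: h_def s_def mult.assoc)
qed (use a w order_trans[OF norm_ge_zero d] in auto)

lemma irgnm_Suc_minimizer: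
  fixes F :: "'a::{real_inner, complete_space} \<Rightarrow> 'b::real_inner"
    and F' :: "'a \<Rightarrow> 'a \<Rightarrow>\<^sub>L 'b" and g :: 'b and x0 :: 'a and n :: nat
  assumes C: "C \<noteq> {}" "closed C" "convex C" and a: "\<alpha> n > 0"
  defines "z \<equiv> irgnm C F F' g \<alpha> x0 n"
  defines "Q \<equiv> tikhonov (F' z) (F' z z - F z + g) (\<alpha> n) x0"
  shows "irgnm C F F' g \<alpha> x0 (Suc n) \<in> C"
    and "y \<in> C \<Longrightarrow> Q (irgnm C F F' g \<alpha> x0 (Suc n)) \<le> Q y"
proof -
  have "(\<lambda>x. (norm (F' z (x - z) + F z - g))\<^sup>2 + \<alpha> n * (norm (x - x0))\<^sup>2) = Q"
    by (simp add: Q_def tikhonov_def blinfun.diff_right fun_eq_iff algebra_simps)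
  then have eq: "irgnm C F F' g \<alpha> x0 (Suc n) = arg_min_on Q C"
    by (simp add: z_def Let_def)
  have ex: "\<exists>x\<in>C. \<forall>y\<in>C. Q x \<le> Q y"
    unfolding Q_def using C a by (rule tikhonov_minimizer_exists)
  show "irgnm C F F' g \<alpha> x0 (Suc n) \<in> C" "y \<in> C \<Longrightarrow> Q (irgnm C F F' g \<alpha> x0 (Suc n)) \<le> Q y"
    unfolding eq by (rule arg_min_on_minimizer[OF ex])+
qed

lemma irgnm_in_domain:
  fixes F :: "'a::{real_inner, complete_space} \<Rightarrow> 'b::real_inner"
  assumes "C \<noteq> {}" "closed C" "convex C" "\<forall>n. \<alpha> n > 0" "x0 \<in> C"
  shows "irgnm C F F' g \<alpha> x0 n \<in> C"
proof (cases n)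
  case (Suc m)
  then show ?thesis using irgnm_Suc_minimizer(1) assms by metis
qed (use assms in simp)

lemma irgnm_step_error:
  fixes F :: "'a::{real_inner, complete_space} \<Rightarrow> 'b::real_inner"
    and F' :: "'a \<Rightarrow> 'a \<Rightarrow>\<^sub>L 'b"
  assumes C: "C \<noteq> {}" "closed C" "convex C" and xd: "xd \<in> C" and L: "0 \<le> L"
    and \<alpha>: "\<forall>n. \<alpha> n > 0" and x0: "x0 \<in> C"
    and src: "xd = metric_projection C (adjoint (F' xd) \<omega> + x0)"
    and noise: "noisy_data C F F' xd (F xd) \<gamma> L Fd Fd' gd \<delta>g \<delta>F \<delta>D"
  defines "X \<equiv> irgnm C Fd Fd' gd \<alpha> x0"
  assumes near: "norm (X n - xd) \<le> \<gamma>"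
  shows "norm (X (Suc n) - xd) \<le>
      2 * (2 * L * (norm (X n - xd))\<^sup>2 + (\<delta>g + \<delta>F)) / sqrt (\<alpha> n) + 2 * norm \<omega> * sqrt (\<alpha> n)
      + 2 * norm \<omega> * (L * norm (X n - xd) + \<delta>D)"
proof -
  define z where "z = X n"
  define b where "b = Fd' z z - Fd z + gd"
  have in_C: "X k \<in> C" for k
    unfolding X_def using C \<alpha> x0 by (rule irgnm_in_domain)
  have N: "\<forall>x\<in>C. has_gateaux_derivative Fd (Fd' x) x C" "norm (F xd - gd) \<le> \<delta>g"
     "norm (F xd - Fd xd) \<le> \<delta>F" "norm (F' xd - Fd' xd) \<le> \<delta>D"
     and lip: "\<forall>x\<in>C. norm (x - xd) \<le> \<gamma> \<longrightarrow> norm (Fd' x - Fd' xd) \<le> L * norm (x - xd)"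
    using noise unfolding noisy_data_def by blast+
  have z: "z \<in> C" "norm (z - xd) \<le> \<gamma>" using in_C near by (simp_all add: z_def)
  have min: "tikhonov (Fd' z) b (\<alpha> n) x0 (X (Suc n)) \<le> tikhonov (Fd' z) b (\<alpha> n) x0 xd"
    using irgnm_Suc_minimizer(2)[where \<alpha> = \<alpha>, OF C \<alpha>[rule_format] xd] unfolding z_def X_def b_def by blast
  have d: "norm (Fd' z - F' xd) \<le> L * norm (z - xd) + \<delta>D"
    using lip[rule_format, OF z] N(4) norm_triangle_ineq4[of "Fd' z - Fd' xd" "F' xd - Fd' xd"] by simp
  have "norm (Fd' z xd - b) = norm ((Fd' z (xd - z) + Fd z - Fd xd) - (F xd - Fd xd) + (F xd - gd))"
    by (simp add: b_def blinfun.diff_right algebra_simps)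
  also have "\<dots> \<le> norm (Fd' z (xd - z) + Fd z - Fd xd) + norm (F xd - Fd xd) + norm (F xd - gd)"
    by (meson add_right_mono norm_triangle_ineq norm_triangle_ineq4 order_trans)
  also have "\<dots> \<le> 2 * L * (norm (z - xd))\<^sup>2 + (\<delta>g + \<delta>F)"
    using gateaux_linearization_error[OF C(3) N(1) lip L xd z] N(2,3) by linarith
  finally have B: "norm (Fd' z xd - b) \<le> 2 * L * (norm (z - xd))\<^sup>2 + (\<delta>g + \<delta>F)" .
  have "norm (X (Suc n) - xd) \<le> 2 * norm (Fd' z xd - b) / sqrt (\<alpha> n) + 2 * norm \<omega> * sqrt (\<alpha> n)
      + 2 * norm \<omega> * (L * norm (z - xd) + \<delta>D)"
    using tikhonov_step_error[OF \<alpha>[rule_format] norm_ge_zero d min] source_condition_inequality[OF C in_C src] .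
  also have "2 * norm (Fd' z xd - b) / sqrt (\<alpha> n) \<le> 2 * (2 * L * (norm (z - xd))\<^sup>2 + (\<delta>g + \<delta>F)) / sqrt (\<alpha> n)"
    using B \<alpha>[rule_format, of n] by (intro divide_right_mono) auto
  finally show ?thesis by (simp add: z_def)
qed

section \<open>Invariance of the rate along the iteration\<close>

text \<open>
  The constant \<open>U\<close> bounds the scaled errors \<open>\<parallel>x\<^sub>n - x\<^sup>\<dagger>\<parallel> / \<surd>\<alpha>\<^sub>n\<close>. The hypothesis \<open>closing\<close> says that the recursion
  maps \<open>[0, U]\<close> into itself, the factor \<open>\<surd>r\<close> paying for the passage from \<open>\<alpha>\<^sub>n\<close> to \<open>\<alpha>\<^sub>n\<^sub>+\<^sub>1\<close>. Since \<open>\<alpha>\<close>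
  decreases, \<open>U \<surd>\<alpha>\<^sub>0 \<le> \<gamma>\<close> keeps all iterates in the ball where the Lipschitz bound holds. The
  induction starts because the source inequality at \<open>x = x\<^sub>0\<close> gives \<open>\<parallel>x\<^sub>0 - x\<^sup>\<dagger>\<parallel> \<le> \<parallel>\<omega>\<parallel> \<parallel>T\<parallel>\<close>.
\<close>

lemma irgnm_error_invariant:
  fixes F :: "'a::{real_inner, complete_space} \<Rightarrow> 'b::real_inner"
    and F' :: "'a \<Rightarrow> 'a \<Rightarrow>\<^sub>L 'b"
  assumes C: "C \<noteq> {}" "closed C" "convex C" and xd: "xd \<in> C" and L: "0 \<le> L"
    and \<alpha>: "\<forall>n. \<alpha> n > 0" "\<forall>n. \<alpha> (Suc n) \<le> \<alpha> n" "\<forall>n. \<alpha> n \<le> r * \<alpha> (Suc n)" and x0: "x0 \<in> C"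
    and src: "xd = metric_projection C (adjoint (F' xd) \<omega> + x0)"
    and noise: "noisy_data C F F' xd (F xd) \<gamma> L Fd Fd' gd \<delta>g \<delta>F \<delta>D"
    and \<tau>: "0 \<le> \<tau>" "\<forall>n<N. total_noise \<delta>g \<delta>F \<delta>D \<le> \<tau>\<^sup>2 * \<alpha> n"
    and U: "0 \<le> U" "U * sqrt (\<alpha> 0) \<le> \<gamma>"
    and start: "norm \<omega> * norm (F' xd) \<le> U * sqrt (\<alpha> 0)"
    and closing: "sqrt r * (2 * (2 * L * U\<^sup>2 + \<tau>\<^sup>2) + 2 * norm \<omega> + 2 * norm \<omega> * (L * U + \<tau>)) \<le> U"
    and n: "n \<le> N"
  shows "norm (irgnm C Fd Fd' gd \<alpha> x0 n - xd) \<le> U * sqrt (\<alpha> n)"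
  using n
proof (induction n)
  case 0
  define e where "e = norm (x0 - xd)"
  have "e * e = inner (x0 - xd) (x0 - xd)"
    unfolding e_def by (metis power2_norm_eq_inner power2_eq_square)
  also have "\<dots> \<le> norm \<omega> * norm (F' xd (x0 - xd))"
    by (rule source_condition_inequality[OF C x0 src])
  also have "\<dots> \<le> norm \<omega> * (norm (F' xd) * e)"
    unfolding e_def by (intro mult_left_mono norm_blinfun norm_ge_zero)
  finally have "e * e \<le> (norm \<omega> * norm (F' xd)) * e" by (simp add: mult.assoc)
  then have "e \<le> norm \<omega> * norm (F' xd)"
    using mult_right_le_imp_le[of e e "norm \<omega> * norm (F' xd)"] norm_ge_zero[of "x0 - xd"]
      mult_nonneg_nonneg[OF norm_ge_zero[of \<omega>] norm_ge_zero[of "F' xd"]]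
    unfolding e_def by linarith
  with start show ?case by (simp add: e_def)
next
  case (Suc n)
  define X where "X = irgnm C Fd Fd' gd \<alpha> x0"
  define q where "q = sqrt (\<alpha> n)"
  define e where "e = norm (X n - xd)"
  have pos: "\<alpha> k > 0" for k using \<alpha>(1) by blast
  have q: "q > 0" "q\<^sup>2 = \<alpha> n" using pos[of n] by (simp_all add: q_def)
  have e: "0 \<le> e" "e \<le> U * q" using Suc by (simp_all add: e_def X_def q_def)
  have "antimono \<alpha>" using \<alpha>(2) by (simp add: decseq_Suc_iff)
  then have "q \<le> sqrt (\<alpha> 0)" by (simp add: q_def decseqD)
  then have "U * q \<le> U * sqrt (\<alpha> 0)" using U(1) by (rule mult_left_mono)
  then have near: "norm (X n - xd) \<le> \<gamma>" using e U(2) by (simp add: e_def)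
  have tn: "total_noise \<delta>g \<delta>F \<delta>D \<le> (\<tau> * q)\<^sup>2" using \<tau>(2) Suc.prems q by (simp add: power_mult_distrib)
  then have d1: "\<delta>g + \<delta>F \<le> \<tau>\<^sup>2 * q\<^sup>2" and D: "\<delta>D\<^sup>2 \<le> (\<tau> * q)\<^sup>2"
    by (simp_all add: total_noise_def power_mult_distrib)
  have d2: "\<delta>D \<le> \<tau> * q"
    using D by (rule power2_le_imp_le) (use \<tau>(1) q(1) in simp)
  have "e\<^sup>2 \<le> U\<^sup>2 * q\<^sup>2" using power_mono[OF e(2,1), of 2] by (simp add: power_mult_distrib)
  then have e2: "2 * L * e\<^sup>2 \<le> 2 * L * (U\<^sup>2 * q\<^sup>2)" using L by (intro mult_left_mono) auto
  have e1: "L * e \<le> L * (U * q)" using e L by (intro mult_left_mono)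
  have "norm (X (Suc n) - xd) \<le> 2 * (2 * L * e\<^sup>2 + (\<delta>g + \<delta>F)) / q + 2 * norm \<omega> * q + 2 * norm \<omega> * (L * e + \<delta>D)"
    using irgnm_step_error[OF C xd L \<alpha>(1) x0 src noise] near unfolding X_def e_def q_def by blast
  also have "\<dots> \<le> 2 * ((2 * L * U\<^sup>2 + \<tau>\<^sup>2) * q\<^sup>2) / q + 2 * norm \<omega> * q + 2 * norm \<omega> * ((L * U + \<tau>) * q)"
    using e1 e2 d1 d2 q(1)
    by (intro add_mono mult_left_mono divide_right_mono) (auto simp: algebra_simps)
  also have "\<dots> = (2 * (2 * L * U\<^sup>2 + \<tau>\<^sup>2) + 2 * norm \<omega> + 2 * norm \<omega> * (L * U + \<tau>)) * q"
    using q(1) by (simp add: field_simps power2_eq_square)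
  also have "\<dots> \<le> (2 * (2 * L * U\<^sup>2 + \<tau>\<^sup>2) + 2 * norm \<omega> + 2 * norm \<omega> * (L * U + \<tau>)) * (sqrt r * sqrt (\<alpha> (Suc n)))"
  proof (rule mult_left_mono)
    show "q \<le> sqrt r * sqrt (\<alpha> (Suc n))"
      using \<alpha>(3) by (simp add: q_def flip: real_sqrt_mult)
  qed (use L U \<tau>(1) in auto)
  also have "\<dots> \<le> U * sqrt (\<alpha> (Suc n))"
    using mult_right_mono[OF closing, of "sqrt (\<alpha> (Suc n))"] pos[of "Suc n"] by (simp add: mult_ac)
  finally show ?case by (simp add: X_def)
qed

text \<open>
  The budget for the recursion: the quadratic term and the data noise may each use up \<open>U / 4\<close>, the terms
  with \<open>\<parallel>\<omega>\<parallel>\<close> together \<open>U / 2\<close>. The condition \<open>16 \<surd>r L U \<le> 1\<close> bounds \<open>U\<close> through \<open>L\<close> and \<open>r\<close> alone; the smallness of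
  \<open>\<tau>\<close> and \<open>w\<close> is then relative to \<open>U\<close>, which fixes the order of choice.
\<close>

lemma closing_constants:
  fixes L r U w \<tau> :: real
  assumes "0 \<le> L" "1 \<le> r" "0 \<le> U" "0 \<le> w" "0 \<le> \<tau>"
    and "16 * sqrt r * L * U \<le> 1" "\<tau> \<le> 1" "8 * sqrt r * \<tau>\<^sup>2 \<le> U" "12 * sqrt r * w \<le> U"
  shows "sqrt r * (2 * (2 * L * U\<^sup>2 + \<tau>\<^sup>2) + 2 * w + 2 * w * (L * U + \<tau>)) \<le> U"
proof -
  define k where "k = sqrt r"
  have k: "1 \<le> k" using assms by (simp add: k_def)
  have "1 * (L * U) \<le> k * (L * U)" using k assms by (intro mult_right_mono) auto
  then have LU: "L * U \<le> 1" using assms(6) by (simp add: k_def algebra_simps)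
  have "(k * w) * (L * U + \<tau>) \<le> (k * w) * 2" using LU assms k by (intro mult_left_mono) auto
  moreover have "(16 * k * L * U) * U \<le> 1 * U" using assms by (intro mult_right_mono) (auto simp: k_def)
  ultimately show ?thesis
    using assms(8,9) by (fold k_def) (simp add: algebra_simps power2_eq_square)
qed

section \<open>Convergence rate of the iteration\<close>

theorem theorem2p1:
  fixes C :: "'x::{real_inner, complete_space} set"
    and F :: "'x \<Rightarrow> 'y::{real_inner, complete_space}"
    and F' :: "'x \<Rightarrow> 'x \<Rightarrow>\<^sub>L 'y"
    and xd :: 'x and g :: 'y
    and \<gamma> L r :: real and \<alpha> :: "nat \<Rightarrow> real"
  assumes "C \<noteq> {}" and "closed C" and "convex C"
    and "\<forall>x\<in>C. has_gateaux_derivative F (F' x) x C"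
    and "xd \<in> C" and "F xd = g"
    and "\<gamma> > 0" and "L > 0" and "r > 1"
    and "\<forall>n. 1 \<le> \<alpha> n / \<alpha> (Suc n) \<and> \<alpha> n / \<alpha> (Suc n) \<le> r"
    and "\<alpha> \<longlonglongrightarrow> 0" and "\<forall>n. \<alpha> n > 0"
  shows "\<exists>\<rho>\<^sub>0>0. \<forall>\<rho>\<le>\<rho>\<^sub>0. \<forall>x\<^sub>0\<in>C.
    (\<exists>\<omega>. norm \<omega> \<le> \<rho> \<and> xd = metric_projection C (adjoint (blinfun_apply (F' xd)) \<omega> + x\<^sub>0)) \<longrightarrow>
    (\<not> inj (blinfun_apply (F' xd)) \<longrightarrow>
       xd = arg_min_on (\<lambda>x. norm (x - x\<^sub>0)) {x \<in> C. blinfun_apply (F' xd) (x - xd) = 0}) \<longrightarrow>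
    (\<forall>F\<^sub>\<delta> F\<^sub>\<delta>' g\<^sub>\<delta> \<delta>\<^sub>g \<delta>\<^sub>F \<delta>\<^sub>D.
       noisy_data C F F' xd g \<gamma> L F\<^sub>\<delta> F\<^sub>\<delta>' g\<^sub>\<delta> \<delta>\<^sub>g \<delta>\<^sub>F \<delta>\<^sub>D \<longrightarrow>
       total_noise \<delta>\<^sub>g \<delta>\<^sub>F \<delta>\<^sub>D = 0 \<longrightarrow>
         (\<forall>n. norm (irgnm C F\<^sub>\<delta> F\<^sub>\<delta>' g\<^sub>\<delta> \<alpha> x\<^sub>0 n - xd) \<le> \<gamma>) \<and>
         (\<lambda>n. norm (irgnm C F\<^sub>\<delta> F\<^sub>\<delta>' g\<^sub>\<delta> \<alpha> x\<^sub>0 n - xd)) \<in> O(\<lambda>n. sqrt (\<alpha> n))) \<and>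
    (\<exists>\<eta>\<^sub>0>0. \<forall>\<eta>\<ge>\<eta>\<^sub>0.
       (\<forall>F\<^sub>\<delta> F\<^sub>\<delta>' g\<^sub>\<delta> \<delta>\<^sub>g \<delta>\<^sub>F \<delta>\<^sub>D N.
          noisy_data C F F' xd g \<gamma> L F\<^sub>\<delta> F\<^sub>\<delta>' g\<^sub>\<delta> \<delta>\<^sub>g \<delta>\<^sub>F \<delta>\<^sub>D \<longrightarrow>
          total_noise \<delta>\<^sub>g \<delta>\<^sub>F \<delta>\<^sub>D > 0 \<longrightarrow>
          stopping_index \<alpha> \<eta> (total_noise \<delta>\<^sub>g \<delta>\<^sub>F \<delta>\<^sub>D) N \<longrightarrow>
            (\<forall>n\<le>N. norm (irgnm C F\<^sub>\<delta> F\<^sub>\<delta>' g\<^sub>\<delta> \<alpha> x\<^sub>0 n - xd) \<le> \<gamma>)) \<and>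
       (\<exists>K. \<forall>\<^sub>F \<delta> in at_right 0. \<forall>F\<^sub>\<delta> F\<^sub>\<delta>' g\<^sub>\<delta> \<delta>\<^sub>g \<delta>\<^sub>F \<delta>\<^sub>D N.
          noisy_data C F F' xd g \<gamma> L F\<^sub>\<delta> F\<^sub>\<delta>' g\<^sub>\<delta> \<delta>\<^sub>g \<delta>\<^sub>F \<delta>\<^sub>D \<longrightarrow>
          total_noise \<delta>\<^sub>g \<delta>\<^sub>F \<delta>\<^sub>D = \<delta> \<longrightarrow>
          stopping_index \<alpha> \<eta> \<delta> N \<longrightarrow>
            norm (irgnm C F\<^sub>\<delta> F\<^sub>\<delta>' g\<^sub>\<delta> \<alpha> x\<^sub>0 N - xd) \<le> K * sqrt \<delta>))"
proof -
  note C = assms(1-3) and xd = assms(5) and g = assms(6) and \<gamma> = assms(7) and L = assms(8) and r = assms(9)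
  have \<alpha>: "\<forall>n. \<alpha> n > 0" using assms(12) .
  have anti: "\<forall>n. \<alpha> (Suc n) \<le> \<alpha> n" and rate: "\<forall>n. \<alpha> n \<le> r * \<alpha> (Suc n)"
    using assms(10) \<alpha> by (simp_all add: field_simps)
  \<comment> \<open>The first entry keeps the iterates in the ball of radius \<open>\<gamma>\<close>, the second makes the quadratic term
      of the recursion harmless.\<close>
  define U where "U = min (\<gamma> / sqrt (\<alpha> 0)) (1 / (16 * sqrt r * L))"
  have a0: "sqrt (\<alpha> 0) > 0" using \<alpha> by simp
  have r1: "sqrt r > 0" "1 \<le> r" using r by simp_all
  have U: "U > 0" using \<gamma> a0 r1 L by (simp add: U_def)
  have U\<gamma>: "U * sqrt (\<alpha> 0) \<le> \<gamma>"
    using a0 by (simp add: U_def flip: pos_le_divide_eq)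
  have UL: "16 * sqrt r * L * U \<le> 1"
  proof -
    have "U \<le> 1 / (16 * sqrt r * L)" by (simp add: U_def)
    then show ?thesis using r1 L by (simp add: field_simps)
  qed
  \<comment> \<open>The first entry limits the contribution of \<open>\<omega>\<close> to each step, the second makes the initial
      error at most \<open>U \<surd>\<alpha>\<^sub>0\<close>; the \<open>+ 1\<close> avoids division by zero when \<open>F'[x\<^sup>\<dagger>] = 0\<close>.\<close>
  define \<rho>\<^sub>0 where "\<rho>\<^sub>0 = min (U / (12 * sqrt r)) (U * sqrt (\<alpha> 0) / (norm (F' xd) + 1))"
  have nT: "norm (F' xd) + 1 > 0" by (simp add: add_nonneg_pos)
  have \<rho>\<^sub>0: "\<rho>\<^sub>0 > 0" using U r1 a0 nT by (simp add: \<rho>\<^sub>0_def)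
  have sub: "norm (irgnm C Fd Fd' gd \<alpha> x\<^sub>0 n - xd) \<le> U * sqrt (\<alpha> n)"
    if \<omega>: "norm \<omega> \<le> \<rho>\<^sub>0" "xd = metric_projection C (adjoint (F' xd) \<omega> + x\<^sub>0)" and x0: "x\<^sub>0 \<in> C"
      and noise: "noisy_data C F F' xd g \<gamma> L Fd Fd' gd \<delta>g \<delta>F \<delta>D"
      and \<tau>: "0 \<le> \<tau>" "\<tau> \<le> 1" "8 * sqrt r * \<tau>\<^sup>2 \<le> U" "\<forall>n<N. total_noise \<delta>g \<delta>F \<delta>D \<le> \<tau>\<^sup>2 * \<alpha> n"
      and n: "n \<le> N"
    for \<omega> x\<^sub>0 Fd Fd' gd \<delta>g \<delta>F \<delta>D \<tau> N n
  proof -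
    have w12: "12 * sqrt r * norm \<omega> \<le> U"
      using \<omega>(1) r1 by (simp add: \<rho>\<^sub>0_def field_simps)
    have "norm \<omega> * norm (F' xd) \<le> norm \<omega> * (norm (F' xd) + 1)" by (intro mult_left_mono) auto
    also have "\<dots> \<le> U * sqrt (\<alpha> 0)"
      using \<omega>(1) nT by (simp add: \<rho>\<^sub>0_def flip: pos_le_divide_eq)
    finally have start: "norm \<omega> * norm (F' xd) \<le> U * sqrt (\<alpha> 0)" .
    have noise': "noisy_data C F F' xd (F xd) \<gamma> L Fd Fd' gd \<delta>g \<delta>F \<delta>D" using noise g by simp
    have closing: "sqrt r * (2 * (2 * L * U\<^sup>2 + \<tau>\<^sup>2) + 2 * norm \<omega> + 2 * norm \<omega> * (L * U + \<tau>)) \<le> U"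
      using closing_constants[OF less_imp_le[OF L] r1(2) less_imp_le[OF U] norm_ge_zero \<tau>(1) UL \<tau>(2,3) w12] .
    show ?thesis
      by (rule irgnm_error_invariant[OF C xd less_imp_le[OF L] \<alpha> anti rate x0 \<omega>(2) noise' \<tau>(1,4)
            less_imp_le[OF U] U\<gamma> start closing n])
  qed
  have U_le_\<gamma>: "U * sqrt (\<alpha> n) \<le> \<gamma>" for n
  proof -
    have "sqrt (\<alpha> n) \<le> sqrt (\<alpha> 0)" using anti by (simp add: decseqD decseq_Suc_iff)
    then show ?thesis using U U\<gamma> by (meson less_imp_le mult_left_mono order_trans)
  qed
  show ?thesis
  proof (rule exI[of _ \<rho>\<^sub>0], intro conjI allI ballI impI \<rho>\<^sub>0)
    fix \<rho> x\<^sub>0 assume \<rho>: "\<rho> \<le> \<rho>\<^sub>0" and x0: "x\<^sub>0 \<in> C"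
      and "\<exists>\<omega>. norm \<omega> \<le> \<rho> \<and> xd = metric_projection C (adjoint (F' xd) \<omega> + x\<^sub>0)"
    then obtain \<omega> where \<omega>: "norm \<omega> \<le> \<rho>\<^sub>0" "xd = metric_projection C (adjoint (F' xd) \<omega> + x\<^sub>0)"
      by force
    have exact: "norm (irgnm C Fd Fd' gd \<alpha> x\<^sub>0 n - xd) \<le> U * sqrt (\<alpha> n)"
      if "noisy_data C F F' xd g \<gamma> L Fd Fd' gd \<delta>g \<delta>F \<delta>D" "total_noise \<delta>g \<delta>F \<delta>D = 0"
      for Fd Fd' gd \<delta>g \<delta>F \<delta>D n
      using sub[OF \<omega> x0 that(1), of 0 n n] that(2) U by simp
    {
      fix Fd Fd' gd \<delta>g \<delta>F \<delta>D n
      assume "noisy_data C F F' xd g \<gamma> L Fd Fd' gd \<delta>g \<delta>F \<delta>D" "total_noise \<delta>g \<delta>F \<delta>D = 0"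
      from exact[OF this] show "norm (irgnm C Fd Fd' gd \<alpha> x\<^sub>0 n - xd) \<le> \<gamma>"
        using U_le_\<gamma> order_trans by blast
    }
    {
      fix Fd Fd' gd \<delta>g \<delta>F \<delta>D
      assume "noisy_data C F F' xd g \<gamma> L Fd Fd' gd \<delta>g \<delta>F \<delta>D" "total_noise \<delta>g \<delta>F \<delta>D = 0"
      from exact[OF this] show "(\<lambda>n. norm (irgnm C Fd Fd' gd \<alpha> x\<^sub>0 n - xd)) \<in> O(\<lambda>n. sqrt (\<alpha> n))"
        using \<alpha> by (intro bigoI[of _ U]) (simp add: less_imp_le)
    }
    \<comment> \<open>With \<open>\<tau> = 1/\<surd>\<eta>\<close> these are the conditions \<open>\<tau> \<le> 1\<close> and \<open>8 \<surd>r \<tau>\<^sup>2 \<le> U\<close>.\<close>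
    define \<eta>\<^sub>0 where "\<eta>\<^sub>0 = max 1 (8 * sqrt r / U)"
    have noisy: "norm (irgnm C Fd Fd' gd \<alpha> x\<^sub>0 n - xd) \<le> U * sqrt (\<alpha> n)"
      if \<eta>: "\<eta> \<ge> \<eta>\<^sub>0" and noise: "noisy_data C F F' xd g \<gamma> L Fd Fd' gd \<delta>g \<delta>F \<delta>D"
        and stop: "stopping_index \<alpha> \<eta> (total_noise \<delta>g \<delta>F \<delta>D) N" and n: "n \<le> N"
      for \<eta> Fd Fd' gd \<delta>g \<delta>F \<delta>D N n
    proof -
      have \<eta>1: "1 \<le> \<eta>" "8 * sqrt r \<le> U * \<eta>"
        using \<eta> U by (simp_all add: \<eta>\<^sub>0_def field_simps)
      show ?thesis
      proof (rule sub[OF \<omega> x0 noise, where \<tau> = "1 / sqrt \<eta>", OF _ _ _ _ n])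
        show "8 * sqrt r * (1 / sqrt \<eta>)\<^sup>2 \<le> U"
          using \<eta>1 by (simp add: field_simps)
        show "\<forall>n<N. total_noise \<delta>g \<delta>F \<delta>D \<le> (1 / sqrt \<eta>)\<^sup>2 * \<alpha> n"
          using stop \<eta>1 by (simp add: stopping_index_def field_simps)
      qed (use \<eta>1 in simp_all)
    qed
    show "\<exists>\<eta>\<^sub>0>0. \<forall>\<eta>\<ge>\<eta>\<^sub>0.
       (\<forall>F\<^sub>\<delta> F\<^sub>\<delta>' g\<^sub>\<delta> \<delta>\<^sub>g \<delta>\<^sub>F \<delta>\<^sub>D N.
          noisy_data C F F' xd g \<gamma> L F\<^sub>\<delta> F\<^sub>\<delta>' g\<^sub>\<delta> \<delta>\<^sub>g \<delta>\<^sub>F \<delta>\<^sub>D \<longrightarrow>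
          total_noise \<delta>\<^sub>g \<delta>\<^sub>F \<delta>\<^sub>D > 0 \<longrightarrow>
          stopping_index \<alpha> \<eta> (total_noise \<delta>\<^sub>g \<delta>\<^sub>F \<delta>\<^sub>D) N \<longrightarrow>
            (\<forall>n\<le>N. norm (irgnm C F\<^sub>\<delta> F\<^sub>\<delta>' g\<^sub>\<delta> \<alpha> x\<^sub>0 n - xd) \<le> \<gamma>)) \<and>
       (\<exists>K. \<forall>\<^sub>F \<delta> in at_right 0. \<forall>F\<^sub>\<delta> F\<^sub>\<delta>' g\<^sub>\<delta> \<delta>\<^sub>g \<delta>\<^sub>F \<delta>\<^sub>D N.
          noisy_data C F F' xd g \<gamma> L F\<^sub>\<delta> F\<^sub>\<delta>' g\<^sub>\<delta> \<delta>\<^sub>g \<delta>\<^sub>F \<delta>\<^sub>D \<longrightarrow>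
          total_noise \<delta>\<^sub>g \<delta>\<^sub>F \<delta>\<^sub>D = \<delta> \<longrightarrow>
          stopping_index \<alpha> \<eta> \<delta> N \<longrightarrow>
            norm (irgnm C F\<^sub>\<delta> F\<^sub>\<delta>' g\<^sub>\<delta> \<alpha> x\<^sub>0 N - xd) \<le> K * sqrt \<delta>)"
    proof (rule exI[of _ \<eta>\<^sub>0], intro conjI allI impI)
      show "\<eta>\<^sub>0 > 0" by (simp add: \<eta>\<^sub>0_def)
      fix \<eta> assume \<eta>: "\<eta> \<ge> \<eta>\<^sub>0"
      {
        fix Fd Fd' gd \<delta>g \<delta>F \<delta>D and N n :: nat
        assume "noisy_data C F F' xd g \<gamma> L Fd Fd' gd \<delta>g \<delta>F \<delta>D"
          "stopping_index \<alpha> \<eta> (total_noise \<delta>g \<delta>F \<delta>D) N" "n \<le> N"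
        from noisy[OF \<eta> this] show "norm (irgnm C Fd Fd' gd \<alpha> x\<^sub>0 n - xd) \<le> \<gamma>"
          using U_le_\<gamma> order_trans by blast
      }
      have "norm (irgnm C Fd Fd' gd \<alpha> x\<^sub>0 N - xd) \<le> U * sqrt \<eta> * sqrt \<delta>"
        if "noisy_data C F F' xd g \<gamma> L Fd Fd' gd \<delta>g \<delta>F \<delta>D" "total_noise \<delta>g \<delta>F \<delta>D = \<delta>"
          "stopping_index \<alpha> \<eta> \<delta> N" for Fd Fd' gd \<delta>g \<delta>F \<delta>D \<delta> N
      proof -
        have "norm (irgnm C Fd Fd' gd \<alpha> x\<^sub>0 N - xd) \<le> U * sqrt (\<alpha> N)"
          using noisy[OF \<eta> that(1)] that by simp
        also have "\<dots> \<le> U * sqrt (\<eta> * \<delta>)"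
          using that(3) U by (simp add: stopping_index_def)
        finally show ?thesis by (simp add: real_sqrt_mult mult.assoc)
      qed
      then show "\<exists>K. \<forall>\<^sub>F \<delta> in at_right 0. \<forall>F\<^sub>\<delta> F\<^sub>\<delta>' g\<^sub>\<delta> \<delta>\<^sub>g \<delta>\<^sub>F \<delta>\<^sub>D N.
          noisy_data C F F' xd g \<gamma> L F\<^sub>\<delta> F\<^sub>\<delta>' g\<^sub>\<delta> \<delta>\<^sub>g \<delta>\<^sub>F \<delta>\<^sub>D \<longrightarrow>
          total_noise \<delta>\<^sub>g \<delta>\<^sub>F \<delta>\<^sub>D = \<delta> \<longrightarrow>
          stopping_index \<alpha> \<eta> \<delta> N \<longrightarrow>
            norm (irgnm C F\<^sub>\<delta> F\<^sub>\<delta>' g\<^sub>\<delta> \<alpha> x\<^sub>0 N - xd) \<le> K * sqrt \<delta>"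
        by (intro exI[of _ "U * sqrt \<eta>"] always_eventually) blast
    qed
  qed
qed

end
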